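(* Let $\mathcal{X}=[m]$ with $m\ge2$ and let $(\mathcal{X},\mathcal{E})$ be a strongly connected directed graph with $\mathcal{E}$ symmetric. For $(i,j)\in T(\mathcal{E})$ let $g_{ij}=\delta_i^{\intercal}\delta_j+\delta_j^{\intercal}\delta_i$, i.e. $g_{ij}(x,x')=\delta_i(x)\delta_j(x')+\delta_j(x)\delta_i(x')$. Then the family $(g_{ij})_{(i,j)\in T(\mathcal{E})}$ (more precisely, the family of their cosets) forms a basis of the quotient vector space $\mathcal{G}_{\mathsf{rev}}(\mathcal{X},\mathcal{E})=\mathcal{F}_{\mathsf{rev}}(\mathcal{X},\mathcal{E})/\mathcal{N}(\mathcal{X},\mathcal{E})$.
   Context: $\mathcal{E}\subset\mathcal{X}^2$ symmetric means $(x,x')\in\mathcal{E}\iff(x',x)\in\mathcal{E}$. $\delta_i(x)=1$ if $x=i$ and $0$ otherwise (as a row vector $\delta_i\in\mathbb{R}^{\mathcal{X}}$). $T(\mathcal{E})=\{(x,x')\in\mathcal{E}: x'\le x,\ (x,x')\ne(m,x_\star)\}$ with $x_\star=\min\{x\in\mathcal{X}:(m,x)\in\mathcal{E}\}$. $\mathcal{F}(\mathcal{X},\mathcal{E})$: real functions on $\mathcal{X}^2$ vanishing outside $\mathcal{E}$. $\mathcal{N}(\mathcal{X},\mathcal{E})$: those $h\in\mathcal{F}(\mathcal{X},\mathcal{E})$ for which there are $c\in\mathbb{R}$, $f\in\mathbb{R}^{\mathcal{X}}$ with $h(x,x')=f(x')-f(x)+c$ for all $(x,x')\in\mathcal{E}$.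 $\mathcal{F}_{\mathsf{rev}}(\mathcal{X},\mathcal{E})$: log-reversible $h\in\mathcal{F}(\mathcal{X},\mathcal{E})$, i.e. for every finite directed closed path $(x_1,x_2),\dots,(x_n,x_{n+1})$ of edges in $\mathcal{E}$ with $x_{n+1}=x_1$ (vertices may repeat), $\sum_{t=1}^nh(x_t,x_{t+1})=\sum_{t=1}^nh(x_{t+1},x_t)$. $\mathcal{N}(\mathcal{X},\mathcal{E})$ is a linear subspace of $\mathcal{F}_{\mathsf{rev}}(\mathcal{X},\mathcal{E})$. *)

theory Defs
  imports "HOL-Algebra.AbelCoset" "Jordan_Normal_Form.VS_Connect" "Graph_Theory.Digraph_Component"
begin

section \<open>Spaces of edge functions\<close>

text \<open>A function on the square of the vertex set that vanishes outside the edge set is represented by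
  its extension by zero to all pairs of elements of the vertex type.\<close>

definition edge_funs :: "('v \<times> 'v) set \<Rightarrow> ('v \<Rightarrow> 'v \<Rightarrow> real) set" where
  "edge_funs E = {h. \<forall>x x'. (x, x') \<notin> E \<longrightarrow> h x x' = 0}"

definition null_funs :: "('v \<times> 'v) set \<Rightarrow> ('v \<Rightarrow> 'v \<Rightarrow> real) set" where
  "null_funs E = {h \<in> edge_funs E. \<exists>c f. \<forall>x x'. (x, x') \<in> E \<longrightarrow> h x x' = f x' - f x + c}"

definition rev_funs :: "('v \<times> 'v) set \<Rightarrow> ('v \<Rightarrow> 'v \<Rightarrow> real) set" where
  "rev_funs E = {h \<in> edge_funs E. \<forall>(n::nat) (x :: nat \<Rightarrow> 'v).
     1 \<le> n \<and> (\<forall>t\<in>{1..n}. (x t, x (t + 1)) \<in> E) \<and> x (n + 1) = x 1 \<longrightarrow>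
     (\<Sum>t=1..n. h (x t) (x (t + 1))) = (\<Sum>t=1..n. h (x (t + 1)) (x t))}"

text \<open>The real vector space with pointwise operations on a set of edge functions. The fields
  \<open>mult\<close> and \<open>one\<close> of the record play no role.\<close>

definition fun_vs :: "('v \<Rightarrow> 'v \<Rightarrow> real) set \<Rightarrow> (real, 'v \<Rightarrow> 'v \<Rightarrow> real) module" where
  "fun_vs S = \<lparr>carrier = S,
     monoid.mult = undefined, one = undefined,
     zero = (\<lambda>x x'. 0), add = (\<lambda>g h x x'. g x x' + h x x'),
     module.smult = (\<lambda>a h x x'. a * h x x')\<rparr>"

section \<open>Quotient modules\<close>

text \<open>The scalar multiple of a coset is written as a union so that it needs no choice of a
  representative: all cosets in the union coincide when \<open>N\<close> is a submodule.\<close>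

definition quot_module :: "('a, 'b, 'c) module_scheme \<Rightarrow> 'b set \<Rightarrow> ('a, 'b set) module" where
  "quot_module M N = \<lparr>carrier = a_rcosets\<^bsub>M\<^esub> N,
     monoid.mult = undefined, one = undefined,
     zero = N, add = set_add M,
     module.smult = (\<lambda>a A. \<Union>v\<in>A. N +>\<^bsub>M\<^esub> (a \<odot>\<^bsub>M\<^esub> v))\<rparr>"

definition rev_quot :: "('v \<times> 'v) set \<Rightarrow> (real, ('v \<Rightarrow> 'v \<Rightarrow> real) set) module" where
  "rev_quot E = quot_module (fun_vs (rev_funs E)) (null_funs E)"

section \<open>The generators\<close>

definition delta :: "'v \<Rightarrow> 'v \<Rightarrow> real" where
  "delta i x = (if x = i then 1 else 0)"

definition g_fun :: "'v \<Rightarrow> 'v \<Rightarrow> 'v \<Rightarrow> 'v \<Rightarrow> real" where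
  "g_fun i j = (\<lambda>x x'. delta i x * delta j x' + delta j x * delta i x')"

definition x_star :: "nat \<Rightarrow> (nat \<times> nat) set \<Rightarrow> nat" where
  "x_star m E = Min {x \<in> {1..m}. (m, x) \<in> E}"

definition T_set :: "nat \<Rightarrow> (nat \<times> nat) set \<Rightarrow> (nat \<times> nat) set" where
  "T_set m E = {(x, x') \<in> E. x' \<le> x \<and> (x, x') \<noteq> (m, x_star m E)}"

section \<open>The quotient is a vector space\<close>

lemma vectorspace_fun_vs:
  fixes S :: "('v \<Rightarrow> 'v \<Rightarrow> real) set"
  assumes zero: "(\<lambda>x x'. 0) \<in> S"
    and add: "\<And>g h. g \<in> S \<Longrightarrow> h \<in> S \<Longrightarrow> (\<lambda>x x'. g x x' + h x x') \<in> S"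
    and scale: "\<And>a h. h \<in> S \<Longrightarrow> (\<lambda>x x'. a * h x x') \<in> S"
  shows "vectorspace class_ring (fun_vs S)"
proof -
  have neg: "\<exists>h\<in>S. (\<lambda>x x'. g x x' + h x x') = (\<lambda>x x'. 0)" if "g \<in> S" for g
    using scale[OF that, of "-1"] by (intro bexI[of _ "\<lambda>x x'. - g x x'"]) auto
  have "Module.module class_ring (fun_vs S)"
    by (rule module_criteria)
      (use zero add scale neg class_cring.is_cring in
        \<open>auto simp: fun_vs_def algebra_simps\<close>)
  then show ?thesis
    by (simp add: vectorspace_def class_field)
qed

lemma vectorspace_quot_module:
  assumes "VectorSpace.subspace K N M"
  shows "vectorspace K (quot_module M N)"
proof -
  interpret V: vectorspace K M
    using assms by (simp add: VectorSpace.subspace_def)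
  interpret S: submodule K N M
    using assms by (simp add: VectorSpace.subspace_def)
  have sub: "abelian_subgroup N M"
  proof (rule abelian_subgroupI3)
    show "additive_subgroup N M"
    proof (rule additive_subgroup.intro, rule V.add.subgroupI)
      fix v assume v: "v \<in> N"
      have "\<ominus>\<^bsub>K\<^esub> \<one>\<^bsub>K\<^esub> \<odot>\<^bsub>M\<^esub> v \<in> N"
        using v by simp
      moreover have "\<ominus>\<^bsub>K\<^esub> \<one>\<^bsub>K\<^esub> \<odot>\<^bsub>M\<^esub> v = \<ominus>\<^bsub>M\<^esub> v"
        using v S.subset by (metis V.R.one_closed V.smult_l_minus V.smult_one subsetD)
      ultimately show "\<ominus>\<^bsub>M\<^esub> v \<in> N"
        by simp
    next
      show "N \<noteq> {}"
        using S.zero_closed by blast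
    qed (use S.subset in auto)
    show "abelian_group M" ..
  qed
  interpret N: abelian_subgroup N M by (rule sub)
  have add: "(N +>\<^bsub>M\<^esub> v) <+>\<^bsub>M\<^esub> (N +>\<^bsub>M\<^esub> w) = N +>\<^bsub>M\<^esub> (v \<oplus>\<^bsub>M\<^esub> w)"
    if "v \<in> carrier M" "w \<in> carrier M" for v w
    using that by (rule N.a_rcos_sum)
  have smult: "(\<Union>u\<in>N +>\<^bsub>M\<^esub> v. N +>\<^bsub>M\<^esub> (a \<odot>\<^bsub>M\<^esub> u)) = N +>\<^bsub>M\<^esub> (a \<odot>\<^bsub>M\<^esub> v)"
    if a: "a \<in> carrier K" and v: "v \<in> carrier M" for a v
  proof -
    have "N +>\<^bsub>M\<^esub> (a \<odot>\<^bsub>M\<^esub> u) = N +>\<^bsub>M\<^esub> (a \<odot>\<^bsub>M\<^esub> v)" if u: "u \<in> N +>\<^bsub>M\<^esub> v" for u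
    proof -
      obtain k where k: "k \<in> N" "u = k \<oplus>\<^bsub>M\<^esub> v"
        using u by (auto simp: a_r_coset_def')
      have "a \<odot>\<^bsub>M\<^esub> u = a \<odot>\<^bsub>M\<^esub> k \<oplus>\<^bsub>M\<^esub> a \<odot>\<^bsub>M\<^esub> v"
        using k a v S.subset V.smult_r_distr by auto
      moreover have "a \<odot>\<^bsub>M\<^esub> k \<in> N"
        using a k by simp
      ultimately have "a \<odot>\<^bsub>M\<^esub> u \<in> N +>\<^bsub>M\<^esub> (a \<odot>\<^bsub>M\<^esub> v)"
        by (auto simp: a_r_coset_def')
      then show ?thesis
        using N.a_repr_independence' a v by (metis V.smult_closed)
    qed
    then have "(\<Union>u\<in>N +>\<^bsub>M\<^esub> v. N +>\<^bsub>M\<^esub> (a \<odot>\<^bsub>M\<^esub> u)) = (\<Union>u\<in>N +>\<^bsub>M\<^esub> v. N +>\<^bsub>M\<^esub> (a \<odot>\<^bsub>M\<^esub> v))"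
      by (rule SUP_cong[OF refl])
    moreover have "N +>\<^bsub>M\<^esub> v \<noteq> {}"
      using N.a_rcos_self[OF v] by blast
    ultimately show ?thesis by simp
  qed
  have zero: "N +>\<^bsub>M\<^esub> \<zero>\<^bsub>M\<^esub> = N"
    using S.subset by (simp add: V.a_coset_add_zero)
  have mem: "N +>\<^bsub>M\<^esub> v \<in> carrier (quot_module M N)" if "v \<in> carrier M" for v
    using that by (auto simp: quot_module_def A_RCOSETS_def')
  have ops: "(N +>\<^bsub>M\<^esub> v) \<oplus>\<^bsub>quot_module M N\<^esub> (N +>\<^bsub>M\<^esub> w) = N +>\<^bsub>M\<^esub> (v \<oplus>\<^bsub>M\<^esub> w)"
    if "v \<in> carrier M" "w \<in> carrier M" for v w
    using add[OF that] by (simp add: quot_module_def)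
  have ops2: "a \<odot>\<^bsub>quot_module M N\<^esub> (N +>\<^bsub>M\<^esub> v) = N +>\<^bsub>M\<^esub> (a \<odot>\<^bsub>M\<^esub> v)"
    if "a \<in> carrier K" "v \<in> carrier M" for a v
    using smult[OF that] by (simp add: quot_module_def)
  have ops0: "\<zero>\<^bsub>quot_module M N\<^esub> = N +>\<^bsub>M\<^esub> \<zero>\<^bsub>M\<^esub>"
    by (simp add: quot_module_def zero)
  let ?Q = "quot_module M N"
  have "abelian_group ?Q"
  proof (rule abelian_groupI)
    fix A B assume A: "A \<in> carrier ?Q" and B: "B \<in> carrier ?Q"
    then obtain v w where v: "v \<in> carrier M" "A = N +>\<^bsub>M\<^esub> v" and w: "w \<in> carrier M" "B = N +>\<^bsub>M\<^esub> w"
      by (auto simp: quot_module_def A_RCOSETS_def')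
    show "A \<oplus>\<^bsub>?Q\<^esub> B \<in> carrier ?Q"
      using v w by (simp add: ops mem)
    show "A \<oplus>\<^bsub>?Q\<^esub> B = B \<oplus>\<^bsub>?Q\<^esub> A"
      using v w by (simp add: ops V.a_comm)
    show "\<zero>\<^bsub>?Q\<^esub> \<oplus>\<^bsub>?Q\<^esub> A = A"
      using v by (simp add: ops ops0)
    show "\<exists>y\<in>carrier ?Q. y \<oplus>\<^bsub>?Q\<^esub> A = \<zero>\<^bsub>?Q\<^esub>"
      using v by (intro bexI[of _ "N +>\<^bsub>M\<^esub> (\<ominus>\<^bsub>M\<^esub> v)"]) (simp_all add: ops ops0 mem V.l_neg)
    fix C assume "C \<in> carrier ?Q"
    then obtain u where u: "u \<in> carrier M" "C = N +>\<^bsub>M\<^esub> u"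
      by (auto simp: quot_module_def A_RCOSETS_def')
    show "(A \<oplus>\<^bsub>?Q\<^esub> B) \<oplus>\<^bsub>?Q\<^esub> C = A \<oplus>\<^bsub>?Q\<^esub> (B \<oplus>\<^bsub>?Q\<^esub> C)"
      using v w u by (simp add: ops V.a_assoc)
  next
    show "\<zero>\<^bsub>?Q\<^esub> \<in> carrier ?Q"
      by (simp add: ops0 mem)
  qed
  moreover have "module_axioms K ?Q"
  proof (rule module_axioms.intro)
    fix a b A assume a: "a \<in> carrier K" and b: "b \<in> carrier K" and "A \<in> carrier ?Q"
    then obtain v where v: "v \<in> carrier M" "A = N +>\<^bsub>M\<^esub> v"
      by (auto simp: quot_module_def A_RCOSETS_def')
    show "(a \<oplus>\<^bsub>K\<^esub> b) \<odot>\<^bsub>?Q\<^esub> A = a \<odot>\<^bsub>?Q\<^esub> A \<oplus>\<^bsub>?Q\<^esub> b \<odot>\<^bsub>?Q\<^esub> A"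
      using a b v by (simp add: ops ops2 V.smult_l_distr)
    show "(a \<otimes>\<^bsub>K\<^esub> b) \<odot>\<^bsub>?Q\<^esub> A = a \<odot>\<^bsub>?Q\<^esub> (b \<odot>\<^bsub>?Q\<^esub> A)"
      using a b v by (simp add: ops2 V.smult_assoc1)
  next
    fix a A B assume a: "a \<in> carrier K" and "A \<in> carrier ?Q" "B \<in> carrier ?Q"
    then obtain v w where v: "v \<in> carrier M" "A = N +>\<^bsub>M\<^esub> v"
      and w: "w \<in> carrier M" "B = N +>\<^bsub>M\<^esub> w"
      by (auto simp: quot_module_def A_RCOSETS_def')
    show "a \<odot>\<^bsub>?Q\<^esub> (A \<oplus>\<^bsub>?Q\<^esub> B) = a \<odot>\<^bsub>?Q\<^esub> A \<oplus>\<^bsub>?Q\<^esub> a \<odot>\<^bsub>?Q\<^esub> B"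
      using a v w by (simp add: ops ops2 V.smult_r_distr)
  next
    fix a A assume a: "a \<in> carrier K" and "A \<in> carrier ?Q"
    then obtain v where v: "v \<in> carrier M" "A = N +>\<^bsub>M\<^esub> v"
      by (auto simp: quot_module_def A_RCOSETS_def')
    show "a \<odot>\<^bsub>?Q\<^esub> A \<in> carrier ?Q"
      using a v by (simp add: ops2 mem)
  next
    fix A assume "A \<in> carrier ?Q"
    then obtain v where v: "v \<in> carrier M" "A = N +>\<^bsub>M\<^esub> v"
      by (auto simp: quot_module_def A_RCOSETS_def')
    show "\<one>\<^bsub>K\<^esub> \<odot>\<^bsub>?Q\<^esub> A = A"
      using v by (simp add: ops2)
  qed
  ultimately have "Module.module K ?Q"
    by (simp add: Module.module_def V.R.is_cring)
  then show ?thesis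
    by (simp add: vectorspace_def V.field.field_axioms)
qed

lemma vectorspace_rev_funs: "vectorspace class_ring (fun_vs (rev_funs E))"
  by (rule vectorspace_fun_vs)
    (auto simp: rev_funs_def edge_funs_def sum.distrib simp flip: sum_distrib_left)

lemma null_funs_subset_rev_funs:
  assumes "sym E"
  shows "null_funs E \<subseteq> rev_funs E"
proof
  fix h assume "h \<in> null_funs E"
  then obtain c f where h: "h \<in> edge_funs E"
    and cf: "\<And>x x'. (x, x') \<in> E \<Longrightarrow> h x x' = f x' - f x + c"
    by (auto simp: null_funs_def)
  have "(\<Sum>t=1..n. h (x t) (x (t + 1))) = (\<Sum>t=1..n. h (x (t + 1)) (x t))"
    if n: "1 \<le> n" and E: "\<forall>t\<in>{1..n}. (x t, x (t + 1)) \<in> E" and closed: "x (n + 1) = x 1"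
    for n :: nat and x
  proof -
    have tel: "(\<Sum>t=1..n. f (x (t + 1)) - f (x t)) = 0"
      using sum_Suc_diff[of 1 n "\<lambda>t. f (x t)"] n closed by simp
    have "(\<Sum>t=1..n. h (x t) (x (t + 1))) = (\<Sum>t=1..n. (f (x (t + 1)) - f (x t)) + c)"
      using E by (intro sum.cong) (auto simp: cf)
    moreover have "(\<Sum>t=1..n. h (x (t + 1)) (x t)) = (\<Sum>t=1..n. c - (f (x (t + 1)) - f (x t)))"
    proof (rule sum.cong)
      fix t assume "t \<in> {1..n}"
      then have "(x (t + 1), x t) \<in> E"
        using E assms by (auto dest: symD)
      then show "h (x (t + 1)) (x t) = c - (f (x (t + 1)) - f (x t))"
        by (simp add: cf)
    qed simp
    ultimately show ?thesis
      using tel by (simp only: sum.distrib sum_subtractf)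
  qed
  with h show "h \<in> rev_funs E"
    by (auto simp: rev_funs_def)
qed

lemma subspace_null_funs:
  assumes "sym E"
  shows "VectorSpace.subspace class_ring (null_funs E) (fun_vs (rev_funs E))"
proof -
  have add: "(\<lambda>x x'. g x x' + h x x') \<in> null_funs E" if g: "g \<in> null_funs E" and h: "h \<in> null_funs E" for g h
  proof -
    obtain c f d k where "\<forall>x x'. (x, x') \<in> E \<longrightarrow> g x x' = f x' - f x + c" "\<forall>x x'. (x, x') \<in> E \<longrightarrow> h x x' = k x' - k x + d"
      using g h by (auto simp: null_funs_def)
    then have "\<forall>x x'. (x, x') \<in> E \<longrightarrow> g x x' + h x x' = (f x' + k x') - (f x + k x) + (c + d)"
      by auto
    then have "\<exists>c f. \<forall>x x'. (x, x') \<in> E \<longrightarrow> g x x' + h x x' = f x' - f x + c"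
      by (intro exI[of _ "c + d"] exI[of _ "\<lambda>x. f x + k x"])
    then show ?thesis
      using g h by (simp add: null_funs_def edge_funs_def)
  qed
  have scale: "(\<lambda>x x'. a * h x x') \<in> null_funs E" if h: "h \<in> null_funs E" for a h
  proof -
    obtain c f where "\<forall>x x'. (x, x') \<in> E \<longrightarrow> h x x' = f x' - f x + c"
      using h by (auto simp: null_funs_def)
    then have "\<forall>x x'. (x, x') \<in> E \<longrightarrow> a * h x x' = a * f x' - a * f x + a * c"
      by (simp flip: right_diff_distrib distrib_left)
    then have "\<exists>c f. \<forall>x x'. (x, x') \<in> E \<longrightarrow> a * h x x' = f x' - f x + c"
      by (intro exI[of _ "a * c"] exI[of _ "\<lambda>x. a * f x"])
    then show ?thesis
      using h by (simp add: null_funs_def edge_funs_def)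
  qed
  have zero: "(\<lambda>x x'. 0) \<in> null_funs E"
    by (auto simp: null_funs_def edge_funs_def intro!: exI[of _ 0] exI[of _ "\<lambda>_. 0"])
  have "submodule class_ring (null_funs E) (fun_vs (rev_funs E))"
    using vectorspace_rev_funs[of E] null_funs_subset_rev_funs[OF assms] add scale zero
    by (auto simp: submodule_def vectorspace_def fun_vs_def)
  with vectorspace_rev_funs show ?thesis
    by (simp add: VectorSpace.subspace_def)
qed

theorem vectorspace_rev_quot:
  assumes "sym E"
  shows "vectorspace class_ring (rev_quot E)"
  unfolding rev_quot_def
  by (rule vectorspace_quot_module[OF subspace_null_funs[OF assms]])

end

theory Submission
  imports Defs
begin

text \<open>On a connected graph a log-reversible function is the sum of a symmetric function and a
  gradient: its antisymmetric part sums to zero along closed walks, hence has a potential. So every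
  coset contains a symmetric function, and such functions are spanned by the \<open>g_fun i j\<close> over all
  undirected edges. A symmetric function that lies in \<open>null_funs E\<close> has a gradient part that
  vanishes, so it is constant on \<open>E\<close>. Hence the constants are the only relation,
  and dropping one edge removes it.\<close>

section \<open>Bases of quotients\<close>

text \<open>\<open>basis\<close> is a predicate on sets, so a family also needs injectivity.
  Independence of the family supplies it: if c i = c j with i and j distinct, the coefficients 1 at
  i and -1 at j give a nontrivial relation. Reindexing along \<open>c\<close> then identifies sums
  over \<open>I\<close> with linear combinations of the image.\<close>

lemma (in vectorspace) basis_of_family:
  assumes fin: "finite I" and c: "c \<in> I \<rightarrow> carrier V"
    and indep: "\<And>a. a \<in> I \<rightarrow> carrier K \<Longrightarrow> (\<Oplus>\<^bsub>V\<^esub>i\<in>I. a i \<odot>\<^bsub>V\<^esub> c i) = \<zero>\<^bsub>V\<^esub> \<Longrightarrow> \<forall>i\<in>I. a i = \<zero>\<^bsub>K\<^esub>"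
    and spans: "\<And>v. v \<in> carrier V \<Longrightarrow> \<exists>a\<in>(I \<rightarrow> carrier K). v = (\<Oplus>\<^bsub>V\<^esub>i\<in>I. a i \<odot>\<^bsub>V\<^esub> c i)"
  shows "inj_on c I \<and> basis (c ` I)"
proof -
  have inj: "inj_on c I"
  proof (rule inj_onI, rule ccontr)
    fix i j assume ij: "i \<in> I" "j \<in> I" "c i = c j" "i \<noteq> j"
    define a where "a k = (if k = i then \<one>\<^bsub>K\<^esub> else if k = j then \<ominus>\<^bsub>K\<^esub> \<one>\<^bsub>K\<^esub> else \<zero>\<^bsub>K\<^esub>)" for k
    define J where "J = I - {i, j}"
    have J: "finite J" "i \<notin> J" "j \<notin> J" "I = insert i (insert j J)"
      using ij fin by (auto simp: J_def)
    have a: "a \<in> I \<rightarrow> carrier K"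
      by (auto simp: a_def)
    have cJ: "c k \<in> carrier V" if "k \<in> I" for k
      using c that by auto
    have "(\<Oplus>\<^bsub>V\<^esub>k\<in>J. a k \<odot>\<^bsub>V\<^esub> c k) = (\<Oplus>\<^bsub>V\<^esub>k\<in>J. \<zero>\<^bsub>V\<^esub>)"
      by (rule finsum_cong') (use cJ in \<open>auto simp: a_def J_def\<close>)
    then have J0: "(\<Oplus>\<^bsub>V\<^esub>k\<in>J. a k \<odot>\<^bsub>V\<^esub> c k) = \<zero>\<^bsub>V\<^esub>"
      by simp
    have "(\<Oplus>\<^bsub>V\<^esub>k\<in>I. a k \<odot>\<^bsub>V\<^esub> c k) = a i \<odot>\<^bsub>V\<^esub> c i \<oplus>\<^bsub>V\<^esub> (a j \<odot>\<^bsub>V\<^esub> c j \<oplus>\<^bsub>V\<^esub> \<zero>\<^bsub>V\<^esub>)"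
    proof -
      have t: "a k \<odot>\<^bsub>V\<^esub> c k \<in> carrier V" if "k \<in> I" for k
        using a cJ that by auto
      then have "(\<Oplus>\<^bsub>V\<^esub>k\<in>insert i (insert j J). a k \<odot>\<^bsub>V\<^esub> c k)
          = a i \<odot>\<^bsub>V\<^esub> c i \<oplus>\<^bsub>V\<^esub> (\<Oplus>\<^bsub>V\<^esub>k\<in>insert j J. a k \<odot>\<^bsub>V\<^esub> c k)"
        using J(1,2,4) ij(4) t by (intro finsum_insert) (simp_all add: Pi_def)
      also have "(\<Oplus>\<^bsub>V\<^esub>k\<in>insert j J. a k \<odot>\<^bsub>V\<^esub> c k) = a j \<odot>\<^bsub>V\<^esub> c j \<oplus>\<^bsub>V\<^esub> (\<Oplus>\<^bsub>V\<^esub>k\<in>J. a k \<odot>\<^bsub>V\<^esub> c k)"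
        using J(1,3,4) t by (intro finsum_insert) (simp_all add: Pi_def)
      finally show ?thesis
        unfolding J0 J(4)[symmetric] .
    qed
    also have "\<dots> = c j \<oplus>\<^bsub>V\<^esub> \<ominus>\<^bsub>V\<^esub> c j"
      using ij cJ by (simp add: a_def smult_l_minus)
    also have "\<dots> = \<zero>\<^bsub>V\<^esub>"
      using ij cJ by (simp add: M.r_neg)
    finally have "a i = \<zero>\<^bsub>K\<^esub>"
      using indep[OF a] ij by blast
    then show False
      by (simp add: a_def)
  qed
  have lincomb: "lincomb a (c ` I) = (\<Oplus>\<^bsub>V\<^esub>i\<in>I. a (c i) \<odot>\<^bsub>V\<^esub> c i)" if "a \<in> c ` I \<rightarrow> carrier K" for a
    unfolding lincomb_def by (rule finsum_reindex) (use that c inj in auto)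
  have sub: "c ` I \<subseteq> carrier V"
    using c by auto
  have li: "lin_indpt (c ` I)"
  proof (rule finite_lin_indpt2)
    fix a assume a: "a \<in> c ` I \<rightarrow> carrier K" and "lincomb a (c ` I) = \<zero>\<^bsub>V\<^esub>"
    then have "(\<Oplus>\<^bsub>V\<^esub>i\<in>I. a (c i) \<odot>\<^bsub>V\<^esub> c i) = \<zero>\<^bsub>V\<^esub>"
      using lincomb[OF a] by simp
    moreover have "(\<lambda>i. a (c i)) \<in> I \<rightarrow> carrier K"
      using a by blast
    ultimately show "\<forall>v\<in>c ` I. a v = \<zero>\<^bsub>K\<^esub>"
      using indep by blast
  qed (use fin sub in auto)
  have "v \<in> span (c ` I)" if v: "v \<in> carrier V" for v
  proof -
    obtain a where a: "a \<in> I \<rightarrow> carrier K" "v = (\<Oplus>\<^bsub>V\<^esub>i\<in>I. a i \<odot>\<^bsub>V\<^esub> c i)"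
      using spans[OF v] by blast
    \<comment> \<open>Coefficients indexed by \<open>I\<close> become coefficients on vectors by
      inverting \<open>c\<close>, which is where injectivity enters.\<close>
    define b where "b = a \<circ> the_inv_into I c"
    have b: "b (c i) = a i" if "i \<in> I" for i
      using inj that by (simp add: b_def the_inv_into_f_f)
    then have bK: "b \<in> c ` I \<rightarrow> carrier K"
      using a(1) by auto
    have "v = lincomb b (c ` I)"
      unfolding lincomb[OF bK] a(2)
      by (rule finsum_cong') (use a(1) c b in \<open>auto intro!: smult_closed\<close>)
    then show ?thesis
      using fin bK by (auto simp: span_def)
  qed
  then have "span (c ` I) = carrier V"
    using span_is_subset2[OF sub] by auto
  with inj li sub show ?thesis
    by (simp add: basis_def)
qed

section \<open>The projection onto a quotient module\<close>

lemma (in mod_hom) hom_finsum: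
  assumes "g \<in> I \<rightarrow> carrier M"
  shows "f (\<Oplus>\<^bsub>M\<^esub>i\<in>I. g i) = (\<Oplus>\<^bsub>N\<^esub>i\<in>I. f (g i))"
  using assms
\<comment> \<open>Over an infinite index set both sums are zero by convention, and \<open>f\<close>
  preserves zero.\<close>
proof (induction I rule: infinite_finite_induct)
  case (insert i I)
  then have "(\<Oplus>\<^bsub>N\<^esub>i\<in>insert i I. f (g i)) = f (g i) \<oplus>\<^bsub>N\<^esub> (\<Oplus>\<^bsub>N\<^esub>i\<in>I. f (g i))"
    by (intro finsum_insert) auto
  with insert show ?case
    by simp
qed auto

text \<open>Negation is scaling by -1, so closure under scalars gives closure under negatives. This
  opens the way to the coset calculus for additive subgroups.\<close>

lemma abelian_subgroup_submodule:
  assumes "submodule K N M"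
  shows "abelian_subgroup N M"
proof (rule abelian_subgroupI3)
  interpret S: submodule K N M by (rule assms)
  interpret M: Module.module K M by (rule S.module)
  show "abelian_group M" ..
  show "additive_subgroup N M"
  proof (rule additive_subgroup.intro, rule M.add.subgroupI)
    fix v assume v: "v \<in> N"
    then have "\<ominus>\<^bsub>M\<^esub> v = \<ominus>\<^bsub>K\<^esub> \<one>\<^bsub>K\<^esub> \<odot>\<^bsub>M\<^esub> v"
      using S.subset M.smult_l_minus[of "\<one>\<^bsub>K\<^esub>" v] by auto
    then show "\<ominus>\<^bsub>M\<^esub> v \<in> N"
      using v by simp
  next
    show "N \<noteq> {}"
      using S.zero_closed by blast
  qed (use S.subset in auto)
qed

lemma quot_module_zero_iff:
  assumes "submodule K N M" and "v \<in> carrier M"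
  shows "N +>\<^bsub>M\<^esub> v = \<zero>\<^bsub>quot_module M N\<^esub> \<longleftrightarrow> v \<in> N"
proof -
  interpret N: abelian_subgroup N M
    using assms(1) by (rule abelian_subgroup_submodule)
  show ?thesis
    using N.a_rcos_self[OF assms(2)] N.a_rcos_const by (auto simp: quot_module_def)
qed

lemma linear_map_quot_module:
  assumes "VectorSpace.subspace K N M"
  shows "linear_map K M (quot_module M N) (\<lambda>v. N +>\<^bsub>M\<^esub> v)"
proof -
  interpret V: vectorspace K M
    using assms by (simp add: VectorSpace.subspace_def)
  interpret S: submodule K N M
    using assms by (simp add: VectorSpace.subspace_def)
  interpret N: abelian_subgroup N M
    by (rule abelian_subgroup_submodule) unfold_locales
  interpret Q: vectorspace K "quot_module M N"
    by (rule vectorspace_quot_module[OF assms])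
  have smult: "N +>\<^bsub>M\<^esub> (a \<odot>\<^bsub>M\<^esub> v) = a \<odot>\<^bsub>quot_module M N\<^esub> (N +>\<^bsub>M\<^esub> v)"
    if a: "a \<in> carrier K" and v: "v \<in> carrier M" for a v
  proof -
    \<comment> \<open>Scaling in the quotient is a union over all representatives. Replacing v by u
      = k + v changes the scaled vector only by a multiple of k, which stays in \<open>N\<close>, so
      the union collapses to a single coset.\<close>
    have "N +>\<^bsub>M\<^esub> (a \<odot>\<^bsub>M\<^esub> u) = N +>\<^bsub>M\<^esub> (a \<odot>\<^bsub>M\<^esub> v)" if "u \<in> N +>\<^bsub>M\<^esub> v" for u
    proof -
      obtain k where k: "k \<in> N" "u = k \<oplus>\<^bsub>M\<^esub> v"
        using \<open>u \<in> _\<close> by (auto simp: a_r_coset_def')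
      then have "a \<odot>\<^bsub>M\<^esub> u = a \<odot>\<^bsub>M\<^esub> k \<oplus>\<^bsub>M\<^esub> a \<odot>\<^bsub>M\<^esub> v"
        using a v S.subset V.smult_r_distr by auto
      then have "a \<odot>\<^bsub>M\<^esub> u \<in> N +>\<^bsub>M\<^esub> (a \<odot>\<^bsub>M\<^esub> v)"
        using a k by (auto simp: a_r_coset_def')
      then show ?thesis
        using N.a_repr_independence' a v by (metis V.smult_closed)
    qed
    then have "(\<Union>u\<in>N +>\<^bsub>M\<^esub> v. N +>\<^bsub>M\<^esub> (a \<odot>\<^bsub>M\<^esub> u)) = (\<Union>u\<in>N +>\<^bsub>M\<^esub> v. N +>\<^bsub>M\<^esub> (a \<odot>\<^bsub>M\<^esub> v))"
      by (rule SUP_cong[OF refl])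
    also have "\<dots> = N +>\<^bsub>M\<^esub> (a \<odot>\<^bsub>M\<^esub> v)"
      using N.a_rcos_self[OF v] by auto
    finally show ?thesis
      by (simp add: quot_module_def)
  qed
  show ?thesis
  proof (intro linear_map.intro mod_hom.intro mod_hom_axioms.intro)
    show "(\<lambda>v. N +>\<^bsub>M\<^esub> v) \<in> LinearCombinations.module_hom K M (quot_module M N)"
      using smult N.a_rcos_sum by (auto simp: LinearCombinations.module_hom_def quot_module_def A_RCOSETS_def')
  qed unfold_locales
qed

text \<open>The projection is linear, so a combination of cosets is the coset of the same
  combination of representatives. Both basis conditions can therefore be checked modulo
  \<open>N\<close> without mentioning cosets.\<close>

lemma quot_module_basisI:
  assumes "VectorSpace.subspace K N M" and fin: "finite I" and b: "b \<in> I \<rightarrow> carrier M"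
    and indep: "\<And>a. a \<in> I \<rightarrow> carrier K \<Longrightarrow> (\<Oplus>\<^bsub>M\<^esub>i\<in>I. a i \<odot>\<^bsub>M\<^esub> b i) \<in> N \<Longrightarrow> \<forall>i\<in>I. a i = \<zero>\<^bsub>K\<^esub>"
    and spans: "\<And>v. v \<in> carrier M \<Longrightarrow> \<exists>a\<in>(I \<rightarrow> carrier K). \<exists>n\<in>N. v = n \<oplus>\<^bsub>M\<^esub> (\<Oplus>\<^bsub>M\<^esub>i\<in>I. a i \<odot>\<^bsub>M\<^esub> b i)"
  shows "inj_on (\<lambda>i. N +>\<^bsub>M\<^esub> b i) I
    \<and> vectorspace.basis K (quot_module M N) ((\<lambda>i. N +>\<^bsub>M\<^esub> b i) ` I)"
proof -
  interpret V: vectorspace K M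
    using assms(1) by (simp add: VectorSpace.subspace_def)
  interpret Q: vectorspace K "quot_module M N"
    by (rule vectorspace_quot_module[OF assms(1)])
  interpret P: linear_map K M "quot_module M N" "\<lambda>v. N +>\<^bsub>M\<^esub> v"
    by (rule linear_map_quot_module[OF assms(1)])
  have S: "submodule K N M"
    using assms(1) by (simp add: VectorSpace.subspace_def)
  interpret N: abelian_subgroup N M
    by (rule abelian_subgroup_submodule[OF S])
  have mem: "(\<lambda>i. a i \<odot>\<^bsub>M\<^esub> b i) \<in> I \<rightarrow> carrier M" if "a \<in> I \<rightarrow> carrier K" for a
    using that b by (auto intro!: V.smult_closed)
  have sum: "(\<Oplus>\<^bsub>quot_module M N\<^esub>i\<in>I. a i \<odot>\<^bsub>quot_module M N\<^esub> (N +>\<^bsub>M\<^esub> b i))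
      = N +>\<^bsub>M\<^esub> (\<Oplus>\<^bsub>M\<^esub>i\<in>I. a i \<odot>\<^bsub>M\<^esub> b i)" if a: "a \<in> I \<rightarrow> carrier K" for a
    unfolding P.hom_finsum[OF mem[OF a]]
    by (rule Q.finsum_cong') (use a b mem[OF a] in \<open>auto simp: Pi_def\<close>)
  show ?thesis
  proof (rule Q.basis_of_family[OF fin])
    show "(\<lambda>i. N +>\<^bsub>M\<^esub> b i) \<in> I \<rightarrow> carrier (quot_module M N)"
      using b by auto
  next
    fix a assume a: "a \<in> I \<rightarrow> carrier K"
      and "(\<Oplus>\<^bsub>quot_module M N\<^esub>i\<in>I. a i \<odot>\<^bsub>quot_module M N\<^esub> (N +>\<^bsub>M\<^esub> b i)) = \<zero>\<^bsub>quot_module M N\<^esub>"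
    then have "(\<Oplus>\<^bsub>M\<^esub>i\<in>I. a i \<odot>\<^bsub>M\<^esub> b i) \<in> N"
      using quot_module_zero_iff[OF S V.finsum_closed[OF mem[OF a]]] sum[OF a] by simp
    then show "\<forall>i\<in>I. a i = \<zero>\<^bsub>K\<^esub>"
      by (rule indep[OF a])
  next
    fix w assume "w \<in> carrier (quot_module M N)"
    then obtain v where v: "v \<in> carrier M" "w = N +>\<^bsub>M\<^esub> v"
      by (auto simp: quot_module_def A_RCOSETS_def')
    obtain a n where a: "a \<in> I \<rightarrow> carrier K" and n: "n \<in> N" "v = n \<oplus>\<^bsub>M\<^esub> (\<Oplus>\<^bsub>M\<^esub>i\<in>I. a i \<odot>\<^bsub>M\<^esub> b i)"
      using spans[OF v(1)] by blast
    have "v \<in> N +>\<^bsub>M\<^esub> (\<Oplus>\<^bsub>M\<^esub>i\<in>I. a i \<odot>\<^bsub>M\<^esub> b i)"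
      using n by (auto simp: a_r_coset_def')
    then have "w = N +>\<^bsub>M\<^esub> (\<Oplus>\<^bsub>M\<^esub>i\<in>I. a i \<odot>\<^bsub>M\<^esub> b i)"
      using N.a_repr_independence'[OF _ V.finsum_closed[OF mem[OF a]]] v(2) by simp
    then show "\<exists>a\<in>(I \<rightarrow> carrier K).
        w = (\<Oplus>\<^bsub>quot_module M N\<^esub>i\<in>I. a i \<odot>\<^bsub>quot_module M N\<^esub> (N +>\<^bsub>M\<^esub> b i))"
      using a sum[OF a] by auto
  qed
qed

text \<open>Addition in \<open>fun_vs S\<close> is pointwise, so induction on \<open>I\<close> turns
  the abstract sum into real sums; on infinite sets both default to zero.\<close>

lemma finsum_fun_vs:
  assumes "vectorspace class_ring (fun_vs S)" and "g \<in> I \<rightarrow> S"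
  shows "finsum (fun_vs S) g I = (\<lambda>x x'. \<Sum>i\<in>I. g i x x')"
proof -
  interpret vectorspace class_ring "fun_vs S" by (rule assms(1))
  have simps: "carrier (fun_vs S) = S" "\<zero>\<^bsub>fun_vs S\<^esub> = (\<lambda>x x'. 0)"
    "\<And>g h. g \<oplus>\<^bsub>fun_vs S\<^esub> h = (\<lambda>x x'. g x x' + h x x')"
    by (simp_all add: fun_vs_def)
  show ?thesis
    using assms(2)
  proof (induction I rule: infinite_finite_induct)
    case (insert i I)
    then show ?case
      by (subst finsum_insert) (auto simp: simps Pi_def)
  qed (simp_all add: simps)
qed

section \<open>Potentials\<close>

text \<open>A relation rather than a function of the endpoints, because different walks between the
  same two vertices may have different totals.\<close>

inductive walk_sum :: "('v \<times> 'v) set \<Rightarrow> ('v \<Rightarrow> 'v \<Rightarrow> real) \<Rightarrow> 'v \<Rightarrow> 'v \<Rightarrow> real \<Rightarrow> bool"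
  for E a where
  refl: "walk_sum E a x x 0"
| step: "(x, y) \<in> E \<Longrightarrow> walk_sum E a y z s \<Longrightarrow> walk_sum E a x z (a x y + s)"

lemma walk_sum_trans:
  "walk_sum E a x y s \<Longrightarrow> walk_sum E a y z t \<Longrightarrow> walk_sum E a x z (s + t)"
  by (induction rule: walk_sum.induct) (auto simp: add.assoc intro: walk_sum.step)

lemma walk_sum_of_rtrancl:
  assumes "(x, y) \<in> E\<^sup>*"
  shows "\<exists>s. walk_sum E a x y s"
  using assms by (induction rule: converse_rtrancl_induct) (auto intro: walk_sum.intros)

text \<open>Unfolds the inductive walk into an indexed vertex sequence, the form in which
  \<open>rev_funs\<close> speaks of closed paths.\<close>

lemma walk_sum_vertices:
  "walk_sum E a x y s \<Longrightarrow> \<exists>n p. p 0 = x \<and> p n = y \<and> (\<forall>t<n. (p t, p (Suc t)) \<in> E)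
    \<and> s = (\<Sum>t<n. a (p t) (p (Suc t)))"
proof (induction rule: walk_sum.induct)
  case (refl x)
  show ?case
    by (rule exI[of _ 0], rule exI[of _ "\<lambda>_. x"]) simp
next
  case (step x y z s)
  then obtain n p where p: "p 0 = y" "p n = z" "\<forall>t<n. (p t, p (Suc t)) \<in> E"
    "s = (\<Sum>t<n. a (p t) (p (Suc t)))"
    by blast
  show ?case
    using p step.hyps(1)
    \<comment> \<open>\<open>case_nat x p\<close> puts x in front of the sequence and shifts the
      rest by one.\<close>
    by (intro exI[of _ "Suc n"] exI[of _ "case_nat x p"])
      (auto simp: sum.lessThan_Suc_shift less_Suc_eq_0_disj simp del: sum.lessThan_Suc)
qed

text \<open>Fix a root r and let f x be the total along some walk from r to x. Since closed walks
  have total zero, the difference of f across an edge is forced, whichever walks were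
  chosen.\<close>

lemma potential_exists:
  fixes a :: "'v \<Rightarrow> 'v \<Rightarrow> real"
  assumes conn: "\<And>x y. x \<in> X \<Longrightarrow> y \<in> X \<Longrightarrow> (x, y) \<in> E\<^sup>*" and E: "E \<subseteq> X \<times> X"
    and closed: "\<And>x s. walk_sum E a x x s \<Longrightarrow> s = 0"
  shows "\<exists>f. \<forall>(x, y)\<in>E. a x y = f y - f x"
proof (cases "X = {}")
  case True
  with E show ?thesis by auto
next
  case False
  then obtain r where r: "r \<in> X" by blast
  define f where "f x = (SOME s. walk_sum E a r x s)" for x
  have f: "walk_sum E a r x (f x)" if "x \<in> X" for x
    unfolding f_def by (rule someI_ex, rule walk_sum_of_rtrancl) (use conn r that in auto)
  have "a x y = f y - f x" if xy: "(x, y) \<in> E" for x y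
  proof -
    have X: "x \<in> X" "y \<in> X"
      using xy E by auto
    \<comment> \<open>One return walk from y to r closes up two walks: the chosen one to x followed
      by the edge, and the chosen one to y. Comparing the two zero totals eliminates s.\<close>
    obtain s where s: "walk_sum E a y r s"
      using walk_sum_of_rtrancl conn r X by metis
    have "f x + (a x y + s) = 0"
      by (rule closed, rule walk_sum_trans[OF f[OF X(1)]], rule walk_sum.step[OF xy s])
    moreover have "f y + s = 0"
      by (rule closed, rule walk_sum_trans[OF f[OF X(2)] s])
    ultimately show ?thesis by simp
  qed
  then show ?thesis by blast
qed

text \<open>Log-reversibility equates the forward and backward sums of h around a closed path; their
  difference is the total of the antisymmetrized weight.\<close>

lemma rev_funs_closed_walk:
  assumes h: "h \<in> rev_funs E" and w: "walk_sum E (\<lambda>x y. h x y - h y x) x x s"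
  shows "s = 0"
proof -
  obtain n p where p: "p 0 = x" "p n = x" "\<forall>t<n. (p t, p (Suc t)) \<in> E"
    and s: "s = (\<Sum>t<n. h (p t) (p (Suc t)) - h (p (Suc t)) (p t))"
    using walk_sum_vertices[OF w] by blast
  show ?thesis
  \<comment> \<open>\<open>rev_funs\<close> constrains only paths with at least one edge; the empty
    walk has total zero anyway.\<close>
  proof (cases "n = 0")
    case False
    \<comment> \<open>Paths in \<open>rev_funs\<close> are numbered from 1, while p starts at
      0.\<close>
    define q where "q t = p (t - 1)" for t
    have "(\<Sum>t=1..n. h (q t) (q (t + 1))) = (\<Sum>t=1..n. h (q (t + 1)) (q t))"
    proof -
      have "\<forall>t\<in>{1..n}. (q t, q (t + 1)) \<in> E"
      proof
        fix t assume "t \<in> {1..n}"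
        then have "t - 1 < n" "Suc (t - 1) = t"
          by auto
        then show "(q t, q (t + 1)) \<in> E"
          using p(3)[rule_format, of "t - 1"] by (simp add: q_def del: One_nat_def)
      qed
      moreover have "1 \<le> n" "q (n + 1) = q 1"
        using False p by (simp_all add: q_def)
      ultimately show ?thesis
        using h unfolding rev_funs_def by blast
    qed
    moreover have "(\<Sum>t=1..n. g (q t) (q (t + 1))) = (\<Sum>t<n. g (p t) (p (Suc t)))" for g :: "_ \<Rightarrow> _ \<Rightarrow> real"
      using sum.shift_bounds_Suc_ivl[of "\<lambda>t. g (q t) (q (t + 1))" 0 n]
      by (simp add: q_def atLeastLessThanSuc_atLeastAtMost lessThan_atLeast0)
    from this[of h] this[of "\<lambda>x y. h y x"] have
      "(\<Sum>t=1..n. h (q t) (q (t + 1))) = (\<Sum>t<n. h (p t) (p (Suc t)))"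
      "(\<Sum>t=1..n. h (q (t + 1)) (q t)) = (\<Sum>t<n. h (p (Suc t)) (p t))" .
    ultimately show ?thesis
      by (simp add: s sum_subtractf)
  qed (simp add: s)
qed

section \<open>The generators\<close>

lemma g_fun_sym: "g_fun i j x y = g_fun i j y x"
  by (simp add: g_fun_def mult.commute)

text \<open>Symmetry of the generator makes forward and backward sums agree term by term, and
  symmetry of \<open>E\<close> keeps both orientations of (i, j) inside the edge set.\<close>

lemma g_fun_in_rev_funs:
  assumes "sym E" and "(i, j) \<in> E"
  shows "g_fun i j \<in> rev_funs E"
  using assms by (auto simp: rev_funs_def edge_funs_def g_fun_def delta_def mult.commute dest: symD)

text \<open>Index pairs are ordered with the larger entry first, so at (x, y) with y \<le> x only
  the generator indexed by (x, y) can be nonzero. On a loop its two terms coincide and give 2. Thus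
  coefficients can be read off from values.\<close>

lemma sum_g_fun:
  fixes x y :: "'v :: linorder"
  assumes I: "finite I" "I \<subseteq> {(i, j). j \<le> i}" and "y \<le> x"
  shows "(\<Sum>p\<in>I. a p * (case p of (i, j) \<Rightarrow> g_fun i j) x y)
    = (if (x, y) \<in> I then a (x, y) * (if x = y then 2 else 1) else 0)"
proof -
  have "(\<Sum>p\<in>I. a p * (case p of (i, j) \<Rightarrow> g_fun i j) x y)
      = (\<Sum>p\<in>I. if p = (x, y) then a (x, y) * (if x = y then 2 else 1) else 0)"
    by (rule sum.cong) (use assms in \<open>auto simp: g_fun_def delta_def split: if_splits\<close>)
  then show ?thesis
    using I(1) by simp
qed

text \<open>As m \<ge> 2, a walk from m to 1 is nonempty, so m has an outgoing edge and the minimum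
  is taken over a nonempty finite set.\<close>

lemma x_star_edge:
  assumes "m \<ge> 2" and E: "E \<subseteq> {1..m} \<times> {1..m}" and "(m, 1) \<in> E\<^sup>*"
  shows "(m, x_star m E) \<in> E"
proof -
  have "\<exists>x. (m, x) \<in> E"
    using assms by (metis converse_rtranclE numeral_le_one_iff semiring_norm(69))
  then have "{x \<in> {1..m}. (m, x) \<in> E} \<noteq> {}"
    using E by blast
  then have "x_star m E \<in> {x \<in> {1..m}. (m, x) \<in> E}"
    unfolding x_star_def by (intro Min_in) auto
  then show ?thesis by simp
qed

section \<open>The basis of the reversible quotient\<close>

theorem theorem5p2:
  fixes m :: nat and E :: "(nat \<times> nat) set"
  assumes "m \<ge> 2"
    and "E \<subseteq> {1..m} \<times> {1..m}"
    and "sym E"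
    and "strongly_connected \<lparr>verts = {1..m}, arcs = E, tail = fst, head = snd\<rparr>"
  shows "inj_on (\<lambda>(i, j). null_funs E +>\<^bsub>fun_vs (rev_funs E)\<^esub> g_fun i j) (T_set m E)
    \<and> vectorspace.basis class_ring (rev_quot E)
        ((\<lambda>(i, j). null_funs E +>\<^bsub>fun_vs (rev_funs E)\<^esub> g_fun i j) ` T_set m E)"
proof -
  let ?T = "T_set m E"
  let ?V = "fun_vs (rev_funs E)"
  let ?g = "\<lambda>(i, j). g_fun i j :: nat \<Rightarrow> nat \<Rightarrow> real"
  interpret V: vectorspace class_ring ?V
    by (rule vectorspace_rev_funs)
  have symE: "(y, x) \<in> E" if "(x, y) \<in> E" for x y
    using assms(3) that by (rule symD)
  have conn: "(x, y) \<in> E\<^sup>*" if "x \<in> {1..m}" "y \<in> {1..m}" for x y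
  proof -
    have "(x, y) \<in> (arcs_ends \<lparr>verts = {1..m}, arcs = E, tail = fst, head = snd\<rparr>)\<^sup>*"
      using assms(4) that reachable_rtranclI by (fastforce simp: strongly_connected_def)
    then show ?thesis
      by (simp add: arcs_ends_conv)
  qed
  have star: "(m, x_star m E) \<in> E"
    using assms(1,2) conn by (intro x_star_edge) auto
  have star_le: "x_star m E \<le> m"
    using star assms(2) by auto
  have T: "?T \<subseteq> {(i, j). j \<le> i}" "?T \<subseteq> E" "(m, x_star m E) \<notin> ?T"
    by (auto simp: T_set_def)
  have "finite E"
    using assms(2) finite_subset by blast
  then have fin: "finite ?T"
    using T finite_subset by blast
  have g: "?g \<in> ?T \<rightarrow> rev_funs E"
    using T(2) g_fun_in_rev_funs[OF assms(3)] by auto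
  have sum: "(\<Oplus>\<^bsub>?V\<^esub>p\<in>?T. a p \<odot>\<^bsub>?V\<^esub> ?g p) = (\<lambda>x y. \<Sum>p\<in>?T. a p * ?g p x y)" for a
  proof (subst finsum_fun_vs[OF vectorspace_rev_funs])
    have "a p \<odot>\<^bsub>?V\<^esub> ?g p \<in> carrier ?V" if "p \<in> ?T" for p
      using g that by (intro V.smult_closed) (auto simp: fun_vs_def)
    then show "(\<lambda>p. a p \<odot>\<^bsub>?V\<^esub> ?g p) \<in> ?T \<rightarrow> rev_funs E"
      by (simp add: fun_vs_def)
  qed (simp add: fun_vs_def)
  have sum_sym: "(\<Sum>p\<in>?T. a p * ?g p x y) = (\<Sum>p\<in>?T. a p * ?g p y x)" for a :: "nat \<times> nat \<Rightarrow> real" and x y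
    by (rule sum.cong) (auto simp: g_fun_sym[of _ _ x y])
  have "inj_on (\<lambda>p. null_funs E +>\<^bsub>?V\<^esub> ?g p) ?T
    \<and> vectorspace.basis class_ring (quot_module ?V (null_funs E)) ((\<lambda>p. null_funs E +>\<^bsub>?V\<^esub> ?g p) ` ?T)"
  proof (rule quot_module_basisI[OF subspace_null_funs[OF assms(3)] fin])
    show "?g \<in> ?T \<rightarrow> carrier ?V"
      using g by (simp add: fun_vs_def)
  next
    fix a assume "(\<Oplus>\<^bsub>?V\<^esub>p\<in>?T. a p \<odot>\<^bsub>?V\<^esub> ?g p) \<in> null_funs E"
    then obtain c f where cf: "(\<Sum>p\<in>?T. a p * ?g p x y) = f y - f x + c" if "(x, y) \<in> E" for x y
      unfolding sum null_funs_def by blast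
    \<comment> \<open>Swapping x and y preserves the sum but reverses the sign of the gradient term,
      so averaging both equations leaves c.\<close>
    have const: "(\<Sum>p\<in>?T. a p * ?g p x y) = c" if "(x, y) \<in> E" for x y
      using cf[OF that] cf[OF symE[OF that]] sum_sym[of a x y] by simp
    \<comment> \<open>The omitted edge carries no generator, so the sum vanishes there.\<close>
    have "c = 0"
      using const[OF star] sum_g_fun[OF fin T(1) star_le, of a] T(3) by simp
    have "a (x, y) = 0" if xy: "(x, y) \<in> ?T" for x y
    proof -
      have "y \<le> x" "(x, y) \<in> E"
        using xy T by auto
      then show ?thesis
        using const[of x y] sum_g_fun[OF fin T(1), of y x a] xy \<open>c = 0\<close> by (simp split: if_splits)
    qed
    then show "\<forall>p\<in>?T. a p = \<zero>\<^bsub>class_ring\<^esub>"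
      by auto
  next
    fix h assume "h \<in> carrier ?V"
    then have h: "h \<in> rev_funs E"
      by (simp add: fun_vs_def)
    then have h0: "h x y = 0" if "(x, y) \<notin> E" for x y
      using that by (auto simp: rev_funs_def edge_funs_def)
    have "\<exists>f. \<forall>(x, y)\<in>E. h x y - h y x = f y - f x"
      using conn assms(2) rev_funs_closed_walk[OF h] by (rule potential_exists)
    then obtain f where f: "\<forall>(x, y)\<in>E. h x y - h y x = f y - f x"
      by blast
    txt \<open>The symmetric part \<open>s\<close> represents the coset of \<open>h\<close>; subtracting a constant
      makes the coefficient of the omitted generator vanish.\<close>
    define s where "s x y = (h x y + h y x) / 2" for x y
    define c where "c = s m (x_star m E)"
    \<comment> \<open>The division by 2 compensates for the value 2 of a loop generator on its
      loop.\<close>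
    define a where "a = (\<lambda>(x, y). (s x y - c) / (if x = y then 2 else 1))"
    define n where "n x y = h x y - (\<Sum>p\<in>?T. a p * ?g p x y)" for x y
    \<comment> \<open>The formula also covers the omitted edge: the sum is zero there, and s x y - c
      is zero by the choice of c.\<close>
    have ordered: "(\<Sum>p\<in>?T. a p * ?g p x y) = (if (x, y) \<in> E then s x y - c else 0)" if "y \<le> x" for x y
      using that by (subst sum_g_fun[OF fin T(1)]) (auto simp: a_def T_set_def c_def)
    have all: "(\<Sum>p\<in>?T. a p * ?g p x y) = (if (x, y) \<in> E then s x y - c else 0)" for x y
    proof (cases "y \<le> x")
      case False
      then have "(\<Sum>p\<in>?T. a p * ?g p x y) = (if (y, x) \<in> E then s y x - c else 0)"
        using ordered[of x y] sum_sym[of a x y] by simp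
      then show ?thesis
        using symE by (auto simp: s_def add.commute)
    qed (rule ordered)
    \<comment> \<open>Removing the symmetric part of h leaves half the antisymmetric part, hence the
      gradient of f / 2; the constant c subtracted from s reappears.\<close>
    have "n x y = f y / 2 - f x / 2 + c" if "(x, y) \<in> E" for x y
    proof -
      have "h x y - h y x = f y - f x"
        using f that by auto
      then show ?thesis
        using that by (simp add: n_def all s_def field_simps)
    qed
    then have "n \<in> null_funs E"
      by (auto simp: null_funs_def edge_funs_def n_def all h0 intro!: exI[of _ c] exI[of _ "\<lambda>x. f x / 2"])
    moreover have "h = n \<oplus>\<^bsub>?V\<^esub> (\<Oplus>\<^bsub>?V\<^esub>p\<in>?T. a p \<odot>\<^bsub>?V\<^esub> ?g p)"
      unfolding sum by (simp add: fun_vs_def n_def)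
    ultimately show "\<exists>a\<in>(?T \<rightarrow> carrier class_ring). \<exists>n\<in>null_funs E.
        h = n \<oplus>\<^bsub>?V\<^esub> (\<Oplus>\<^bsub>?V\<^esub>p\<in>?T. a p \<odot>\<^bsub>?V\<^esub> ?g p)"
      by (intro bexI[of _ a] bexI[of _ n]) auto
  qed
  then show ?thesis
    by (simp add: rev_quot_def case_prod_unfold)
qed

end
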